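(* Let $(X,m)$ be a probability space and let $T_n$, $n=1,2,\ldots$, be a sequence of linear operators from $L^1(X,m)$ to the space of measurable functions on $X$, each of which (written $T$) satisfies: (1) if $f\ge0$ then $Tf\ge0$; (2) $T(\mathbb{I}_X)=1$; (3) for any $\varepsilon>0$ there exists $\delta>0$ such that if $E\subset X$ is measurable and $m(E)<\delta$ then $m\{x\in X:\ T\mathbb{I}_E(x)>\varepsilon\}<\varepsilon$. If $\{T_n\}$ is $\delta$-sweeping out for every $0<\delta<1$, then $\{T_n\}$ is strong sweeping out.
   Context: $\mathbb{I}_E$ denotes the indicator function of $E$. For $0<\delta\le1$, a sequence of linear operators $T_n$ is $\delta$-sweeping out if given $\varepsilon>0$ there is a (measurable) set $E\subset X$ with $mE<\varepsilon$ such that $\limsup_{n\to\infty}T_n\mathbb{I}_E(x)\ge\delta$ a.e. The sequence $T_n$ is strong sweeping out if given $\varepsilon>0$ there is a (measurable) set $E$ with $mE<\varepsilon$ such that $\limsup_{n\to\infty}T_n\mathbb{I}_E(x)=1$ a.e. and $\liminf_{n\to\infty}T_n\mathbb{I}_E(x)=0$ a.e. *)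

theory Defs
  imports "HOL-Probability.Probability"
begin

text \<open>
  Elements of L1(M) and of the space of measurable functions modulo null sets are handled
  through representatives of type \<open>'a \<Rightarrow> real\<close>; hence the well-definedness clause, and
  linearity up to a null set that may depend on the arguments.
\<close>

definition linear_L1_operator :: "'a measure \<Rightarrow> (('a \<Rightarrow> real) \<Rightarrow> 'a \<Rightarrow> real) \<Rightarrow> bool" where
  "linear_L1_operator M T \<longleftrightarrow>
     (\<forall>f. integrable M f \<longrightarrow> T f \<in> borel_measurable M) \<and>
     (\<forall>f g. integrable M f \<longrightarrow> integrable M g \<longrightarrow>
        (AE x in M. f x = g x) \<longrightarrow> (AE x in M. T f x = T g x)) \<and>
     (\<forall>f g. integrable M f \<longrightarrow> integrable M g \<longrightarrow>
        (AE x in M. T (\<lambda>y. f y + g y) x = T f x + T g x)) \<and>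
     (\<forall>c f. integrable M f \<longrightarrow> (AE x in M. T (\<lambda>y. c * f y) x = c * T f x))"

text \<open>
  Upper and lower limits are taken in \<^typ>\<open>ereal\<close>, where they always exist.
\<close>

definition delta_sweeping_out ::
  "'a measure \<Rightarrow> (nat \<Rightarrow> ('a \<Rightarrow> real) \<Rightarrow> 'a \<Rightarrow> real) \<Rightarrow> real \<Rightarrow> bool" where
  "delta_sweeping_out M T \<delta> \<longleftrightarrow>
     (\<forall>\<epsilon>>0. \<exists>E\<in>sets M. measure M E < \<epsilon> \<and>
        (AE x in M. limsup (\<lambda>n. ereal (T n (indicator E) x)) \<ge> ereal \<delta>))"

definition strong_sweeping_out ::
  "'a measure \<Rightarrow> (nat \<Rightarrow> ('a \<Rightarrow> real) \<Rightarrow> 'a \<Rightarrow> real) \<Rightarrow> bool" where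
  "strong_sweeping_out M T \<longleftrightarrow>
     (\<forall>\<epsilon>>0. \<exists>E\<in>sets M. measure M E < \<epsilon> \<and>
        (AE x in M. limsup (\<lambda>n. ereal (T n (indicator E) x)) = 1) \<and>
        (AE x in M. liminf (\<lambda>n. ereal (T n (indicator E) x)) = 0))"

end

theory Submission
  imports Defs
begin

text \<open>
  Choose sets \<open>G k\<close> of rapidly decreasing measure and \<open>N k\<close> such that, off a set of measure
  \<open>(1/2)^k\<close>, some \<open>T n (indicator (G k))\<close> with \<open>k < n \<le> N k\<close> exceeds \<open>1 - (1/2)^k\<close>, while all later
  sets together are so small that they are invisible to \<open>T 1, \<dots>, T (N k)\<close>. Almost every point lies
  in only finitely many of the \<open>G k\<close>; let \<open>E\<close> consist of the points for which the last such \<open>k\<close> is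
  even. Up to the later sets, \<open>E\<close> contains \<open>G k\<close> for even \<open>k\<close> and its complement contains \<open>G k\<close> for
  odd \<open>k\<close>, so by Borel--Cantelli both \<open>T n (indicator E)\<close> and \<open>1 - T n (indicator E)\<close> come
  arbitrarily close to \<open>1\<close> infinitely often at almost every point.
\<close>

text \<open>The sequence starts at index 1, so nothing is known about \<open>T 0\<close>; hence the
  guards \<open>n \<ge> 1\<close> throughout. The sweeping-out hypothesis stays outside the locale
  and enters only where small sets are chosen.\<close>

locale positive_unital_operators = prob_space M for M :: "'a measure" +
  fixes T :: "nat \<Rightarrow> ('a \<Rightarrow> real) \<Rightarrow> 'a \<Rightarrow> real"
  assumes linear: "n \<ge> 1 \<Longrightarrow> linear_L1_operator M (T n)"
    and positive: "n \<ge> 1 \<Longrightarrow> integrable M f \<Longrightarrow> (AE x in M. f x \<ge> 0) \<Longrightarrow> (AE x in M. T n f x \<ge> 0)"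
    and unital: "n \<ge> 1 \<Longrightarrow> (AE x in M. T n (indicator (space M)) x = 1)"
    and continuous_in_measure: "n \<ge> 1 \<Longrightarrow> e > 0 \<Longrightarrow>
           \<exists>d>0. \<forall>E\<in>sets M. measure M E < d \<longrightarrow>
             measure M {x \<in> space M. T n (indicator E) x > e} < e"
begin

section \<open>Order and additivity of the operators on indicators\<close>

lemma integrable_indicator_real: "A \<in> sets M \<Longrightarrow> integrable M (indicator A :: 'a \<Rightarrow> real)"
  by (simp add: emeasure_eq_measure)

lemma measurable_T_indicator:
  "n \<ge> 1 \<Longrightarrow> A \<in> sets M \<Longrightarrow> T n (indicator A) \<in> borel_measurable M"
  using linear[of n] integrable_indicator_real[of A] by (auto simp: linear_L1_operator_def)

lemma T_indicator_nonneg: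
  "n \<ge> 1 \<Longrightarrow> A \<in> sets M \<Longrightarrow> AE x in M. 0 \<le> T n (indicator A) x"
  by (intro positive integrable_indicator_real) auto

lemma T_indicator_disjoint_Un:
  assumes "n \<ge> 1" "A \<in> sets M" "B \<in> sets M" "A \<inter> B = {}"
  shows "AE x in M. T n (indicator (A \<union> B)) x = T n (indicator A) x + T n (indicator B) x"
proof -
  have "(indicator (A \<union> B) :: 'a \<Rightarrow> real) = (\<lambda>y. indicator A y + indicator B y)"
    using assms(4) by (auto simp: indicator_def fun_eq_iff)
  then show ?thesis
    using linear[OF assms(1)] integrable_indicator_real[OF assms(2)] integrable_indicator_real[OF assms(3)]
    by (simp add: linear_L1_operator_def)
qed

lemma T_indicator_mono:
  assumes "n \<ge> 1" "A \<in> sets M" "B \<in> sets M" "A \<subseteq> B"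
  shows "AE x in M. T n (indicator A) x \<le> T n (indicator B) x"
proof -
  have "A \<union> (B - A) = B" using assms(4) by auto
  then show ?thesis
    using T_indicator_disjoint_Un[of n A "B - A"] T_indicator_nonneg[of n "B - A"] assms by auto
qed

lemma T_indicator_Compl:
  assumes "n \<ge> 1" "A \<in> sets M"
  shows "AE x in M. T n (indicator (space M - A)) x = 1 - T n (indicator A) x"
proof -
  have "A \<union> (space M - A) = space M" using sets.sets_into_space[OF assms(2)] by auto
  then show ?thesis
    using T_indicator_disjoint_Un[of n A "space M - A"] unital[of n] assms by auto
qed

text \<open>Splitting \<open>E \<union> H\<close> into \<open>E\<close> and \<open>H - E\<close>
  reduces this to additivity and monotonicity. It later bounds \<open>T n (indicator E)\<close> from
  below, with \<open>H\<close> as a negligible error.\<close>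

lemma T_indicator_le_Un:
  assumes "n \<ge> 1" "A \<in> sets M" "E \<in> sets M" "H \<in> sets M" "A \<subseteq> E \<union> H"
  shows "AE x in M. T n (indicator A) x \<le> T n (indicator E) x + T n (indicator H) x"
proof -
  have "AE x in M. T n (indicator A) x \<le> T n (indicator (E \<union> (H - E))) x"
    using assms by (intro T_indicator_mono) auto
  moreover have "AE x in M. T n (indicator (E \<union> (H - E))) x
      = T n (indicator E) x + T n (indicator (H - E)) x"
    using assms by (intro T_indicator_disjoint_Un) auto
  moreover have "AE x in M. T n (indicator (H - E)) x \<le> T n (indicator H) x"
    using assms by (intro T_indicator_mono) auto
  ultimately show ?thesis by eventually_elim auto
qed

section \<open>Exceptional sets for finitely many operators\<close>

definition uncovered :: "nat \<Rightarrow> nat \<Rightarrow> real \<Rightarrow> 'a set \<Rightarrow> 'a set" where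
  "uncovered K N e G = {x \<in> space M. \<forall>n\<in>{K..N}. T n (indicator G) x \<le> 1 - e}"

definition visible :: "nat \<Rightarrow> real \<Rightarrow> 'a set \<Rightarrow> 'a set" where
  "visible N e A = {x \<in> space M. \<exists>n\<in>{1..N}. T n (indicator A) x > e}"

lemma sets_uncovered: "K \<ge> 1 \<Longrightarrow> G \<in> sets M \<Longrightarrow> uncovered K N e G \<in> sets M"
  unfolding uncovered_def
  by (intro sets.sets_Collect_finite_All borel_measurable_le measurable_T_indicator) auto

lemma sets_visible: "A \<in> sets M \<Longrightarrow> visible N e A \<in> sets M"
  unfolding visible_def
  by (intro sets.sets_Collect_finite_Ex borel_measurable_less measurable_T_indicator) auto

text \<open>Only finitely many operators are involved, so continuity in measure can be applied to
  each of them with a fraction of \<open>e\<close>, followed by a union bound.\<close>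

lemma exists_invisible_measure:
  assumes "e > 0"
  shows "\<exists>d>0. \<forall>A\<in>sets M. prob A < d \<longrightarrow> prob (visible N e A) < e"
proof -
  \<comment> \<open>Dividing by \<open>N + 1\<close> covers \<open>N = 0\<close> and makes the sum
    of \<open>N\<close> errors strictly less than \<open>e\<close>.\<close>
  define e' where "e' = e / (real N + 1)"
  have e': "0 < e'" "e' \<le> e" "real N * e' < e"
    using assms by (auto simp: e'_def field_simps)
  have ex_d: "\<forall>n\<in>{1..N}. \<exists>d>0. \<forall>E\<in>sets M. prob E < d \<longrightarrow>
          prob {x \<in> space M. T n (indicator E) x > e'} < e'"
    using continuous_in_measure e'(1) by auto
  obtain d where d_all: "\<forall>n\<in>{1..N}. d n > 0 \<and> (\<forall>E\<in>sets M. prob E < d n \<longrightarrow>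
      prob {x \<in> space M. T n (indicator E) x > e'} < e')"
    by (rule exE[OF bchoice[OF ex_d]])
  have d: "d n > 0"
    "E \<in> sets M \<Longrightarrow> prob E < d n \<Longrightarrow> prob {x \<in> space M. T n (indicator E) x > e'} < e'"
    if "n \<in> {1..N}" for n E
    using bspec[OF d_all that] by simp_all
  \<comment> \<open>The extra element 1 keeps the minimum defined when \<open>N = 0\<close>.\<close>
  define D where "D = Min (insert 1 (d ` {1..N}))"
  have "D > 0" using d(1) by (auto simp: D_def)
  moreover have "prob (visible N e A) < e" if A: "A \<in> sets M" "prob A < D" for A
  proof -
    define B where "B n = {x \<in> space M. T n (indicator A) x > e'}" for n
    have B: "B n \<in> sets M" if "n \<in> {1..N}" for n
      unfolding B_def using that A by (intro borel_measurable_less measurable_T_indicator) auto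
    have "prob (visible N e A) \<le> prob (\<Union>n\<in>{1..N}. B n)"
      using e'(2) B by (intro finite_measure_mono) (force simp: visible_def B_def)+
    also have "\<dots> \<le> (\<Sum>n\<in>{1..N}. prob (B n))"
      using B by (intro finite_measure_subadditive_finite) auto
    also have "\<dots> \<le> (\<Sum>n\<in>{1..N}. e')"
    proof (intro sum_mono)
      fix n assume n: "n \<in> {1..N}"
      then have "D \<le> d n" unfolding D_def by (intro Min_le) auto
      then show "prob (B n) \<le> e'"
        using d(2)[OF n A(1)] A(2) by (simp add: B_def)
    qed
    also have "\<dots> < e" using e'(3) by simp
    finally show ?thesis .
  qed
  ultimately show ?thesis by blast
qed

text \<open>As \<open>N\<close> grows the uncovered sets decrease to a null set, because the limsup
  exceeds \<open>1 - e\<close> almost everywhere; continuity from above then yields a finite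
  \<open>N\<close>.\<close>

lemma exists_small_sweeping_set:
  assumes sweep: "\<And>\<delta>. 0 < \<delta> \<Longrightarrow> \<delta> < 1 \<Longrightarrow> delta_sweeping_out M T \<delta>"
    and "K \<ge> 1" "0 < e" "e \<le> 1" "0 < d"
  shows "\<exists>G\<in>sets M. prob G < d \<and> (\<exists>N. prob (uncovered K N e G) < e)"
proof -
  \<comment> \<open>The level \<open>1 - e / 2\<close> leaves a gap above \<open>1 - e\<close>, so
    that \<open>1 - e\<close> is exceeded strictly and infinitely often.\<close>
  have "delta_sweeping_out M T (1 - e / 2)"
    using assms by (intro sweep) auto
  with \<open>0 < d\<close> obtain G where G: "G \<in> sets M" "prob G < d"
    and sup: "AE x in M. limsup (\<lambda>n. ereal (T n (indicator G) x)) \<ge> ereal (1 - e / 2)"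
    unfolding delta_sweeping_out_def by blast
  have dec: "decseq (\<lambda>N. uncovered K N e G)"
    by (auto simp: decseq_def uncovered_def)
  have sets: "range (\<lambda>N. uncovered K N e G) \<subseteq> sets M"
    using sets_uncovered[OF \<open>K \<ge> 1\<close> G(1)] by auto
  have "AE x in M. x \<notin> (\<Inter>N. uncovered K N e G)"
    using sup
  proof eventually_elim
    case (elim x)
    have "frequently (\<lambda>n. ereal (1 - e) < ereal (T n (indicator G) x)) sequentially"
    proof (rule ccontr)
      assume "\<not> ?thesis"
      then have "eventually (\<lambda>n. ereal (T n (indicator G) x) \<le> ereal (1 - e)) sequentially"
        by (simp add: frequently_def not_less)
      then have "limsup (\<lambda>n. ereal (T n (indicator G) x)) \<le> ereal (1 - e)"
        by (rule Limsup_bounded)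
      with elim have "ereal (1 - e / 2) \<le> ereal (1 - e)" by (rule order_trans)
      then show False using \<open>0 < e\<close> by simp
    qed
    then obtain n where "n \<ge> K" "1 - e < T n (indicator G) x"
      by (auto simp: frequently_sequentially)
    then have "x \<notin> uncovered K n e G" by (force simp: uncovered_def)
    then show ?case by blast
  qed
  then have "prob (\<Inter>N. uncovered K N e G) = 0"
    using sets by (intro prob_eq_0[THEN iffD2]) auto
  then have "(\<lambda>N. prob (uncovered K N e G)) \<longlonglongrightarrow> 0"
    using finite_Lim_measure_decseq[OF sets dec] by simp
  then have "eventually (\<lambda>N. prob (uncovered K N e G) < e) sequentially"
    using \<open>0 < e\<close> by (rule order_tendstoD)
  then have "\<exists>N. prob (uncovered K N e G) < e"
    by (auto simp: eventually_sequentially)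
  with G show ?thesis by blast
qed

section \<open>Inductive choice of the sets and time windows\<close>

lemma exists_sweeping_sequence:
  assumes sweep: "\<And>\<delta>. 0 < \<delta> \<Longrightarrow> \<delta> < 1 \<Longrightarrow> delta_sweeping_out M T \<delta>" and "\<epsilon> > 0"
  obtains G :: "nat \<Rightarrow> 'a set" and N :: "nat \<Rightarrow> nat"
  where "\<And>k. G k \<in> sets M" "prob (\<Union>k. G k) < \<epsilon>"
    "\<And>k. prob (uncovered (Suc k) (N k) ((1/2)^k) (G k)) < (1/2)^k"
    "\<And>k. prob (visible (N k) ((1/2)^k) (\<Union>j. G (Suc k + j))) < (1/2)^k"
proof -
  \<comment> \<open>A stage is a triple of a set, the end of its time window and a budget
    \<open>d\<close>: any set of measure below \<open>d\<close> is invisible up to time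
    \<open>N\<close>.\<close>
  define P :: "nat \<Rightarrow> 'a set \<times> nat \<times> real \<Rightarrow> bool" where
    "P k s = (case s of (G, N, d) \<Rightarrow> G \<in> sets M \<and> 0 < d \<and>
       prob (uncovered (Suc k) N ((1/2)^k) G) < (1/2)^k \<and>
       (\<forall>A\<in>sets M. prob A < d \<longrightarrow> prob (visible N ((1/2)^k) A) < (1/2)^k))" for k s
  \<comment> \<open>The factors 1/4 and 1/2 bound the measures of this and all later sets by
    \<open>c/4\<close>, \<open>c/8\<close>, and so on, with sum \<open>c/2 < c\<close>.\<close>
  define small :: "real \<Rightarrow> 'a set \<times> nat \<times> real \<Rightarrow> bool" where
    "small c s = (case s of (G, N, d) \<Rightarrow> prob G < c / 4 \<and> d \<le> c / 2)" for c s
  have ex: "\<exists>s. P k s \<and> small c s" if "c > 0" for k c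
  proof -
    have "\<exists>G\<in>sets M. prob G < c / 4 \<and> (\<exists>N. prob (uncovered (Suc k) N ((1/2)^k) G) < (1/2)^k)"
      using that by (intro exists_small_sweeping_set sweep) (auto simp: power_le_one)
    then obtain G N where G: "G \<in> sets M" "prob G < c / 4"
      "prob (uncovered (Suc k) N ((1/2)^k) G) < (1/2)^k" by blast
    obtain d where d: "d > 0"
      "\<forall>A\<in>sets M. prob A < d \<longrightarrow> prob (visible N ((1/2)^k) A) < (1/2)^k"
      using exists_invisible_measure[of "(1/2)^k" N] by auto
    show ?thesis
      using G d that by (intro exI[of _ "(G, N, min d (c / 2))"]) (auto simp: P_def small_def)
  qed
  \<comment> \<open>Each stage spends the budget of its predecessor; the clause for
    \<open>k = 0\<close> gives the first stage the budget \<open>\<epsilon>\<close>.\<close>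
  have "\<exists>f. \<forall>k. (P k (f k) \<and> (k = 0 \<longrightarrow> small \<epsilon> (f k))) \<and> small (snd (snd (f k))) (f (Suc k))"
  proof (rule dependent_nat_choice)
    show "\<exists>s. P 0 s \<and> (0 = 0 \<longrightarrow> small \<epsilon> s)"
      using ex[OF \<open>\<epsilon> > 0\<close>, of 0] by auto
  next
    fix s k assume "P k s \<and> (k = 0 \<longrightarrow> small \<epsilon> s)"
    then have "snd (snd s) > 0" by (auto simp: P_def split: prod.splits)
    from ex[OF this] show "\<exists>s'. (P (Suc k) s' \<and> (Suc k = 0 \<longrightarrow> small \<epsilon> s')) \<and> small (snd (snd s)) s'"
      by auto
  qed
  then obtain f where f: "\<And>k. P k (f k)" "small \<epsilon> (f 0)"
    "\<And>k. small (snd (snd (f k))) (f (Suc k))" by auto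
  define G where "G k = fst (f k)" for k
  define N where "N k = fst (snd (f k))" for k
  define d where "d k = snd (snd (f k))" for k
  have fk: "f k = (G k, N k, d k)" for k by (simp add: G_def N_def d_def)
  have G: "G k \<in> sets M" and dpos: "0 < d k"
    and unc: "prob (uncovered (Suc k) (N k) ((1/2)^k) (G k)) < (1/2)^k"
    and vis: "A \<in> sets M \<Longrightarrow> prob A < d k \<Longrightarrow> prob (visible (N k) ((1/2)^k) A) < (1/2)^k" for k A
    using f(1)[of k] by (auto simp: P_def fk)
  have step: "prob (G (Suc k)) < d k / 4" "d (Suc k) \<le> d k / 2" for k
    using f(3)[of k] by (auto simp: small_def fk)
  \<comment> \<open>Used twice: from stage 0 with \<open>c = \<epsilon>\<close> for the whole union,
    and from stage \<open>Suc k\<close> with \<open>c = d k\<close> for the sets after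
    \<open>G k\<close>.\<close>
  have tail: "prob (\<Union>j. G (k + j)) < c"
    if c: "prob (G k) < c / 4" "d k \<le> c / 2" "c > 0" for k c
  proof -
    have dj: "d (k + j) \<le> c / 2 * (1/2)^j" for j
    proof (induction j)
      case (Suc j)
      then show ?case using step(2)[of "k + j"] by simp
    qed (use c in simp)
    have Gj: "prob (G (k + j)) \<le> c / 4 * (1/2)^j" for j
    proof (cases j)
      case (Suc i)
      then show ?thesis using step(1)[of "k + i"] dj[of i] by simp
    qed (use c in simp)
    have sums: "(\<lambda>j. c / 4 * (1/2)^j) sums (c / 2)"
      using sums_mult[OF geometric_sums[of "1/2::real"], of "c / 4"] by simp
    have summ: "summable (\<lambda>j. prob (G (k + j)))"
      by (rule summable_comparison_test'[OF sums_summable[OF sums], of 0]) (use Gj in auto)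
    have "prob (\<Union>j. G (k + j)) \<le> (\<Sum>j. prob (G (k + j)))"
      using G by (intro finite_measure_subadditive_countably summ) auto
    also have "\<dots> \<le> c / 2"
      using suminf_le[OF Gj summ sums_summable[OF sums]] sums_unique[OF sums] by simp
    finally show ?thesis using c by simp
  qed
  show ?thesis
  proof (rule that)
    show "G k \<in> sets M" for k by (rule G)
    show "prob (\<Union>k. G k) < \<epsilon>"
      using tail[of 0 \<epsilon>] f(2) \<open>\<epsilon> > 0\<close> by (simp add: small_def fk)
    show "prob (uncovered (Suc k) (N k) ((1/2)^k) (G k)) < (1/2)^k" for k by (rule unc)
    show "prob (visible (N k) ((1/2)^k) (\<Union>j. G (Suc k + j))) < (1/2)^k" for k
      using G by (intro vis tail step dpos sets.countable_UN) auto
  qed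
qed

section \<open>Borel--Cantelli argument\<close>

text \<open>Almost every point eventually avoids both kinds of exceptional set. For each late
  \<open>k\<close> with the inclusion in \<open>freq\<close>, some \<open>n\<close> in the window of
  \<open>k\<close> then gives \<open>T n (indicator F) x > 1 - 2 * (1/2)^k\<close>. A general
  \<open>F\<close> allows use for a set and for its complement.\<close>

lemma AE_frequently_near_1:
  assumes G: "\<And>k. G k \<in> sets M" and F: "F \<in> sets M"
    and unc: "\<And>k. prob (uncovered (Suc k) (N k) ((1/2)^k) (G k)) < (1/2)^k"
    and vis: "\<And>k. prob (visible (N k) ((1/2)^k) (\<Union>j. G (Suc k + j))) < (1/2)^k"
    and freq: "frequently (\<lambda>k. G k \<subseteq> F \<union> (\<Union>j. G (Suc k + j))) sequentially"
  shows "AE x in M. \<forall>e>0. frequently (\<lambda>n. 1 - e < T n (indicator F) x) sequentially"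
proof -
  define H where "H k = (\<Union>j. G (Suc k + j))" for k
  have H: "H k \<in> sets M" for k unfolding H_def by (intro sets.countable_UN image_subsetI G)
  have summable_half_powers: "summable (\<lambda>k. prob (B k))" if "\<And>k. prob (B k) < (1/2)^k" for B
  proof (rule summable_comparison_test')
    show "summable (\<lambda>k. (1/2::real)^k)" by (rule summable_geometric) simp
    show "norm (prob (B k)) \<le> (1/2)^k" for k using that[of k] by simp
  qed
  have "AE x in M. eventually (\<lambda>k. x \<in> space M - uncovered (Suc k) (N k) ((1/2)^k) (G k)) sequentially"
    by (intro borel_cantelli_AE1 sets_uncovered G summable_half_powers unc) (auto simp: less_top[symmetric])
  moreover have "AE x in M. eventually (\<lambda>k. x \<in> space M - visible (N k) ((1/2)^k) (H k)) sequentially"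
    by (intro borel_cantelli_AE1 sets_visible H summable_half_powers vis[folded H_def])
       (auto simp: less_top[symmetric])
  \<comment> \<open>The null set depends on \<open>k\<close> and \<open>n\<close>; countably many
    pairs allow a common one.\<close>
  moreover have "AE x in M. \<forall>k n. G k \<subseteq> F \<union> H k \<longrightarrow> n \<ge> 1 \<longrightarrow>
      T n (indicator (G k)) x \<le> T n (indicator F) x + T n (indicator (H k)) x"
    unfolding AE_all_countable by (intro allI AE_impI T_indicator_le_Un G F H)
  ultimately show ?thesis
  proof eventually_elim
    case (elim x)
    show ?case
    proof (intro allI impI)
      fix e :: real assume "e > 0"
      have "(\<lambda>k. 2 * (1/2::real)^k) \<longlonglongrightarrow> 2 * 0"
        by (intro tendsto_mult tendsto_const LIMSEQ_power_zero) simp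
      then have ev: "eventually (\<lambda>k. 2 * (1/2::real)^k < e) sequentially"
        using \<open>e > 0\<close> by (intro order_tendstoD) auto
      show "frequently (\<lambda>n. 1 - e < T n (indicator F) x) sequentially"
        unfolding frequently_sequentially
      proof
        fix m
        have "frequently (\<lambda>k. (x \<in> space M - uncovered (Suc k) (N k) ((1/2)^k) (G k)
            \<and> x \<in> space M - visible (N k) ((1/2)^k) (H k) \<and> 2 * (1/2::real)^k < e \<and> k \<ge> m)
            \<and> G k \<subseteq> F \<union> H k) sequentially"
          using freq[folded H_def]
          by (rule frequently_eventually_conj)
             (intro eventually_conj elim(1,2) ev eventually_ge_at_top)
        then obtain k where k: "G k \<subseteq> F \<union> H k" "x \<in> space M"
          "x \<notin> uncovered (Suc k) (N k) ((1/2)^k) (G k)" "x \<notin> visible (N k) ((1/2)^k) (H k)"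
          "2 * (1/2::real)^k < e" "k \<ge> m"
          by (auto dest!: frequently_ex)
        \<comment> \<open>The window bounds serve two ends: \<open>n > k \<ge> m\<close> yields
          arbitrarily late times, and \<open>n \<le> N k\<close> makes \<open>H k\<close> invisible
          to \<open>T n\<close>.\<close>
        from k(2,3) obtain n where n: "n \<in> {Suc k..N k}" "T n (indicator (G k)) x > 1 - (1/2)^k"
          by (auto simp: uncovered_def not_le)
        have "T n (indicator (H k)) x \<le> (1/2)^k"
          using k(2,4) n(1) by (auto simp: visible_def not_less)
        moreover have "T n (indicator (G k)) x \<le> T n (indicator F) x + T n (indicator (H k)) x"
          using elim(3) k(1) n(1) by auto
        ultimately have "1 - e < T n (indicator F) x" using n(2) k(5) by linarith
        then show "\<exists>n\<ge>m. 1 - e < T n (indicator F) x"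
          using n(1) k(6) by (intro exI[of _ n]) auto
      qed
    qed
  qed
qed

section \<open>The parity set and its upper and lower limits\<close>

lemma strong_sweeping_outI:
  assumes sweep: "\<And>\<delta>. 0 < \<delta> \<Longrightarrow> \<delta> < 1 \<Longrightarrow> delta_sweeping_out M T \<delta>"
  shows "strong_sweeping_out M T"
  unfolding strong_sweeping_out_def
proof (intro allI impI)
  fix \<epsilon> :: real assume "\<epsilon> > 0"
  obtain G N where G: "\<And>k. G k \<in> sets M" "prob (\<Union>k. G k) < \<epsilon>"
    and unc: "\<And>k. prob (uncovered (Suc k) (N k) ((1/2)^k) (G k)) < (1/2)^k"
    and vis: "\<And>k. prob (visible (N k) ((1/2)^k) (\<Union>j. G (Suc k + j))) < (1/2)^k"
    by (rule exists_sweeping_sequence[OF sweep \<open>\<epsilon> > 0\<close>]) blast+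
  define H where "H k = (\<Union>j. G (Suc k + j))" for k
  have H: "H k \<in> sets M" for k unfolding H_def by (intro sets.countable_UN image_subsetI G)
  have G_H: "G l \<subseteq> H k" if "k < l" for k l
    using less_imp_Suc_add[OF that] by (auto simp: H_def)
  \<comment> \<open>\<open>G k - H k\<close> consists of the points whose last index is
    \<open>k\<close>. Points in infinitely many \<open>G k\<close> fall outside \<open>E\<close>,
    but they lie in every \<open>H k\<close> and so do not disturb the inclusions below.\<close>
  define E where "E = (\<Union>k\<in>{k. even k}. G k - H k)"
  have E: "E \<in> sets M" unfolding E_def by (intro sets.countable_UN' image_subsetI sets.Diff G H) simp
  have "prob E \<le> prob (\<Union>k. G k)"
    using G by (intro finite_measure_mono) (auto simp: E_def)
  with G(2) have small: "prob E < \<epsilon>" by simp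
  have even_sub: "G k \<subseteq> E \<union> H k" if "even k" for k
    using that by (auto simp: E_def)
  have odd_sub: "G k \<subseteq> (space M - E) \<union> H k" if "odd k" for k
  proof
    fix x assume x: "x \<in> G k"
    have "x \<in> H k" if "x \<in> G l - H l" "even l" for l
    proof -
      \<comment> \<open>Parity excludes \<open>l = k\<close>, and \<open>l < k\<close> would put
        \<open>x\<close> into \<open>H l\<close>.\<close>
      have "k < l" using that x G_H[of l k] \<open>odd k\<close> by (cases k l rule: linorder_cases) auto
      then show ?thesis using that G_H[of k l] by blast
    qed
    then show "x \<in> (space M - E) \<union> H k"
      using x sets.sets_into_space[OF G(1)[of k]] by (auto simp: E_def)
  qed
  have "\<exists>n\<ge>m. even n" "\<exists>n\<ge>m. odd n" for m :: nat
    by (rule exI[of _ "2 * m"], simp) (rule exI[of _ "2 * m + 1"], simp)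
  then have "frequently even sequentially" "frequently odd sequentially"
    by (simp_all add: frequently_sequentially)
  from this(1) have freq_even: "frequently (\<lambda>k. G k \<subseteq> E \<union> H k) sequentially"
    by (rule frequently_elim1) (rule even_sub)
  from \<open>frequently odd sequentially\<close>
  have freq_odd: "frequently (\<lambda>k. G k \<subseteq> (space M - E) \<union> H k) sequentially"
    by (rule frequently_elim1) (rule odd_sub)
  have "AE x in M. \<forall>e>0. frequently (\<lambda>n. 1 - e < T n (indicator E) x) sequentially"
    by (rule AE_frequently_near_1[OF G(1) E unc vis freq_even[unfolded H_def]])
  moreover have "AE x in M. \<forall>e>0. frequently (\<lambda>n. 1 - e < T n (indicator (space M - E)) x) sequentially"
    by (rule AE_frequently_near_1[OF G(1) sets.compl_sets[OF E] unc vis freq_odd[unfolded H_def]])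
  moreover have "AE x in M. \<forall>n. n \<ge> 1 \<longrightarrow> 0 \<le> T n (indicator E) x"
    unfolding AE_all_countable by (intro allI AE_impI T_indicator_nonneg sets.compl_sets E)
  moreover have "AE x in M. \<forall>n. n \<ge> 1 \<longrightarrow> 0 \<le> T n (indicator (space M - E)) x"
    unfolding AE_all_countable by (intro allI AE_impI T_indicator_nonneg sets.compl_sets E)
  moreover have "AE x in M. \<forall>n. n \<ge> 1 \<longrightarrow> T n (indicator (space M - E)) x = 1 - T n (indicator E) x"
    unfolding AE_all_countable by (intro allI AE_impI T_indicator_Compl E)
  ultimately have AE: "AE x in M. limsup (\<lambda>n. ereal (T n (indicator E) x)) = 1 \<and>
      liminf (\<lambda>n. ereal (T n (indicator E) x)) = 0"
  proof eventually_elim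
    case (elim x)
    let ?t = "\<lambda>n. T n (indicator E) x"
    have ge1: "eventually (\<lambda>n. n \<ge> (1::nat)) sequentially" by (rule eventually_ge_at_top)
    have bounds: "eventually (\<lambda>n. 0 \<le> ereal (?t n)) sequentially"
      "eventually (\<lambda>n. ereal (?t n) \<le> 1) sequentially"
      using elim(3-5) by (auto intro!: eventually_mono[OF ge1] simp flip: zero_ereal_def one_ereal_def)
    \<comment> \<open>Values near 1 on the complement are values near 0 on \<open>E\<close>.\<close>
    have low: "frequently (\<lambda>n. ?t n < e) sequentially" if "e > 0" for e
      using frequently_eventually_conj[OF elim(2)[rule_format, OF that] ge1]
      by (rule frequently_elim1) (use elim(5) in auto)
    have "1 \<le> limsup (\<lambda>n. ereal (?t n))"
    proof (rule ccontr)
      assume "\<not> ?thesis"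
      then obtain r where r: "limsup (\<lambda>n. ereal (?t n)) < ereal r" "ereal r < 1"
        using ereal_dense2[of "limsup (\<lambda>n. ereal (?t n))" 1] by (auto simp: not_le)
      have ev: "eventually (\<lambda>n. ereal (?t n) < ereal r) sequentially"
        using r(1) by (rule Limsup_lessD)
      have "frequently (\<lambda>n. r < ?t n) sequentially"
        \<comment> \<open>The choice \<open>e = 1 - r\<close> turns the threshold
          \<open>1 - e\<close> into \<open>r\<close>.\<close>
        using elim(1)[rule_format, of "1 - r"] r(2) by simp
      from frequently_ex[OF frequently_eventually_conj[OF this ev]] show False by auto
    qed
    moreover have "liminf (\<lambda>n. ereal (?t n)) \<le> 0"
    proof (rule ccontr)
      assume "\<not> ?thesis"
      then obtain r where r: "ereal r < liminf (\<lambda>n. ereal (?t n))" "0 < ereal r"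
        using ereal_dense2[of 0 "liminf (\<lambda>n. ereal (?t n))"] by (auto simp: not_le)
      have ev: "eventually (\<lambda>n. ereal r < ereal (?t n)) sequentially"
        using r(1) by (rule less_LiminfD)
      have "frequently (\<lambda>n. ?t n < r) sequentially"
        using low[of r] r(2) by simp
      from frequently_ex[OF frequently_eventually_conj[OF this ev]] show False by auto
    qed
    ultimately show ?case
      using Limsup_bounded[OF bounds(2)] Liminf_bounded[OF bounds(1)] by (auto intro: antisym)
  qed
  show "\<exists>E\<in>sets M. prob E < \<epsilon> \<and>
      (AE x in M. limsup (\<lambda>n. ereal (T n (indicator E) x)) = 1) \<and>
      (AE x in M. liminf (\<lambda>n. ereal (T n (indicator E) x)) = 0)"
    using E small AE by (intro bexI[of _ E]) auto
qed

end

theorem theorem5: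
  fixes M :: "'a measure" and T :: "nat \<Rightarrow> ('a \<Rightarrow> real) \<Rightarrow> 'a \<Rightarrow> real"
  assumes "prob_space M"
    and "\<And>n. n \<ge> 1 \<Longrightarrow> linear_L1_operator M (T n)"
    and "\<And>n f. n \<ge> 1 \<Longrightarrow> integrable M f \<Longrightarrow> (AE x in M. f x \<ge> 0) \<Longrightarrow> (AE x in M. T n f x \<ge> 0)"
    and "\<And>n. n \<ge> 1 \<Longrightarrow> (AE x in M. T n (indicator (space M)) x = 1)"
    and "\<And>n \<epsilon>::real. n \<ge> 1 \<Longrightarrow> \<epsilon> > 0 \<Longrightarrow>
           \<exists>\<delta>>0. \<forall>E\<in>sets M. measure M E < \<delta> \<longrightarrow>
             measure M {x \<in> space M. T n (indicator E) x > \<epsilon>} < \<epsilon>"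
    and "\<And>\<delta>::real. 0 < \<delta> \<Longrightarrow> \<delta> < 1 \<Longrightarrow> delta_sweeping_out M T \<delta>"
  shows "strong_sweeping_out M T"
proof -
  interpret prob_space M by fact
  interpret positive_unital_operators M T
    by unfold_locales (use assms(2-5) in auto)
  show ?thesis by (rule strong_sweeping_outI) (rule assms(6))
qed

end
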